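(* Let $X$ be a real Banach space that is uniformly rotund in every direction. Then the following statements hold. (1) Let $C$ be a non-empty closed convex subset of $X$ and $\mathcal{F} \subseteq CB(X)$. Then $(C,\mathcal{F})$ has property-$(P_1)$ if and only if $(C,\mathcal{F})$ has property-$(lP_2)$. (2) Let $Y$ be any finite dimensional subspace of $X$. Then $(Y, \mathcal{F}')$ has property-$(P_2)$, where $\mathcal{F}'=\{F \in CB(X): rad_Y(F)=1\}$.
   Context: $CL(X)$ and $CB(X)$ denote the sets of non-empty closed, respectively non-empty closed bounded, subsets of $X$; $B_X$ and $S_X$ are the closed unit ball and unit sphere. For $x\in X$ and $F\in CB(X)$, $r(x,F)=\sup\{\|x-a\|: a\in F\}$. For $V\in CL(X)$, $rad_V(F)=\inf\{r(v,F): v\in V\}$, $Z_V(F)=\{v\in V: r(v,F)=rad_V(F)\}$, and for $\delta\ge 0$, $Z_V(F,\delta)=\{v\in V: r(v,F)\le rad_V(F)+\delta\}$. $\mathcal{H}$ is the Hausdorff metric on $CB(X)$: $\mathcal{H}(A,B)=\inf\{r>0: A\subseteq B+rB_X,\ B\subseteq A+rB_X\}$. For $V\in CL(X)$ and $\mathcal{F}\subseteq CB(X)$: - $(V,\mathcal{F})$ has property-$(P_1)$ if for every $G\in\mathcal{F}$: $Z_V(G)\neq\emptyset$ and for every $\epsilon>0$ there exists $\delta>0$ such that $Z_V(G,\delta)\subseteq Z_V(G)+\epsilon B_X$. - $(V,\mathcal{F})$ has property-$(P_2)$ if $Z_V(G)\ne\emptyset$ for every $G\in\mathcal{F}$ and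 for every $\epsilon>0$ there exists $\delta>0$ such that $Z_V(G,\delta)\subseteq Z_V(G)+\epsilon B_X$ for every $G\in\mathcal{F}$. - $(V,\mathcal{F})$ has property-$(lP_2)$ if $Z_V(G)\neq\emptyset$ for every $G\in\mathcal{F}$, and for every $\epsilon>0$ and $F\in\mathcal{F}$ there exists $\delta>0$ such that $Z_V(G,\delta)\subseteq Z_V(G)+\epsilon B_X$ whenever $G\in\mathcal{F}$ and $\mathcal{H}(F,G)<\delta$. $X$ is uniformly rotund with respect to a closed subspace $Y$ if, whenever $(x_n),(y_n)$ are sequences in $S_X$ with $x_n-y_n\in Y$ for every $n\in\mathbb{N}$ and $\|\frac{x_n+y_n}{2}\|\to 1$, one has $x_n-y_n\to 0$. $X$ is uniformly rotund in every direction if $X$ is uniformly rotund with respect to every one dimensional subspace of $X$. *)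

theory Defs
  imports "HOL-Analysis.Analysis"
begin

definition CL :: "'a::real_normed_vector set set"
  where "CL = {A. A \<noteq> {} \<and> closed A}"

definition CB :: "'a::real_normed_vector set set"
  where "CB = {A. A \<noteq> {} \<and> closed A \<and> bounded A}"

text \<open>\<open>enlarge A t\<close> is the algebraic sum \<open>A + t B\<close>, with \<open>B\<close> the closed unit ball. It need not be
  closed, and it can differ from the set of points at distance at most \<open>t\<close> from \<open>A\<close>.\<close>

definition enlarge :: "'a::real_normed_vector set \<Rightarrow> real \<Rightarrow> 'a set"
  where "enlarge A t = {a + t *\<^sub>R b | a b. a \<in> A \<and> b \<in> cball 0 1}"

definition hausdorff_metric :: "'a::real_normed_vector set \<Rightarrow> 'a set \<Rightarrow> real"
  where "hausdorff_metric A B = Inf {t. 0 < t \<and> A \<subseteq> enlarge B t \<and> B \<subseteq> enlarge A t}"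

text \<open>The real-valued \<open>Sup\<close> and \<open>Inf\<close> below (and the \<open>Inf\<close> above) are the intended ones for
  \<open>F \<in> CB\<close> and \<open>V \<in> CL\<close>: the sets concerned are then non-empty and bounded on the relevant side.\<close>

definition far_radius :: "'a::real_normed_vector \<Rightarrow> 'a set \<Rightarrow> real"
  where "far_radius x F = (SUP a\<in>F. norm (x - a))"

definition rad :: "'a::real_normed_vector set \<Rightarrow> 'a set \<Rightarrow> real"
  where "rad V F = (INF v\<in>V. far_radius v F)"

definition centers :: "'a::real_normed_vector set \<Rightarrow> 'a set \<Rightarrow> 'a set"
  where "centers V F = {v \<in> V. far_radius v F = rad V F}"

definition near_centers :: "'a::real_normed_vector set \<Rightarrow> 'a set \<Rightarrow> real \<Rightarrow> 'a set"
  where "near_centers V F \<delta> = {v \<in> V. far_radius v F \<le> rad V F + \<delta>}"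

definition property_P1 :: "'a::real_normed_vector set \<Rightarrow> 'a set set \<Rightarrow> bool"
  where "property_P1 V \<F> \<longleftrightarrow>
    (\<forall>G\<in>\<F>. centers V G \<noteq> {} \<and>
      (\<forall>\<epsilon>>0. \<exists>\<delta>>0. near_centers V G \<delta> \<subseteq> enlarge (centers V G) \<epsilon>))"

definition property_P2 :: "'a::real_normed_vector set \<Rightarrow> 'a set set \<Rightarrow> bool"
  where "property_P2 V \<F> \<longleftrightarrow>
    (\<forall>G\<in>\<F>. centers V G \<noteq> {}) \<and>
    (\<forall>\<epsilon>>0. \<exists>\<delta>>0. \<forall>G\<in>\<F>. near_centers V G \<delta> \<subseteq> enlarge (centers V G) \<epsilon>)"

definition property_lP2 :: "'a::real_normed_vector set \<Rightarrow> 'a set set \<Rightarrow> bool"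
  where "property_lP2 V \<F> \<longleftrightarrow>
    (\<forall>G\<in>\<F>. centers V G \<noteq> {}) \<and>
    (\<forall>\<epsilon>>0. \<forall>F\<in>\<F>. \<exists>\<delta>>0. \<forall>G\<in>\<F>. hausdorff_metric F G < \<delta> \<longrightarrow>
      near_centers V G \<delta> \<subseteq> enlarge (centers V G) \<epsilon>)"

definition uniformly_rotund_wrt :: "'a::real_normed_vector set \<Rightarrow> bool"
  where "uniformly_rotund_wrt Y \<longleftrightarrow>
    (\<forall>x y :: nat \<Rightarrow> 'a.
      (\<forall>n. x n \<in> sphere 0 1) \<and> (\<forall>n. y n \<in> sphere 0 1) \<and> (\<forall>n. x n - y n \<in> Y) \<and>
      (\<lambda>n. norm ((1/2) *\<^sub>R (x n + y n))) \<longlonglongrightarrow> 1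
      \<longrightarrow> (\<lambda>n. x n - y n) \<longlonglongrightarrow> 0)"

text \<open>\<open>dim\<close> is \<open>0\<close> on infinite-dimensional subspaces, so \<open>dim Y = 1\<close> does mean dimension one;
  such subspaces are automatically closed.\<close>

definition uniformly_rotund_every_direction :: "'a::real_normed_vector itself \<Rightarrow> bool"
  where "uniformly_rotund_every_direction _ \<longleftrightarrow>
    (\<forall>Y :: 'a set. subspace Y \<and> dim Y = 1 \<longrightarrow> uniformly_rotund_wrt Y)"

text \<open>Not expressed by \<open>dim\<close>, whose value \<open>0\<close> is ambiguous.\<close>

definition finite_dim_subspace :: "'a::real_normed_vector set \<Rightarrow> bool"
  where "finite_dim_subspace Y \<longleftrightarrow> subspace Y \<and> (\<exists>B. finite B \<and> Y = span B)"

end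

theory Submission
  imports Defs
begin

text \<open>If the norms of \<open>u\<close> and \<open>u - z\<close> are almost at most \<open>1\<close>, with \<open>z \<noteq> 0\<close> fixed, prolong the segment
  between them until both ends hit the unit sphere. Rotundity in the direction \<open>z\<close> pushes the midpoint
  of the longer segment, and by convexity also \<open>u - z/2\<close>, uniformly into the ball. Hence Chebyshev
  centers in convex sets are unique, and (1) follows because the far radius is \<open>1\<close>-Lipschitz in the
  Hausdorff metric. For (2), a failure of uniformity produces centers and almost-centers whose
  differences lie in a bounded part of \<open>Y\<close>; a limit \<open>z \<noteq> 0\<close> of these differences shows that midpoints
  have far radius below \<open>1\<close>.\<close>

section \<open>Rotundity in a direction\<close>

text \<open>Replaces the sequential definition by a modulus. If no \<open>\<delta>\<close> worked,
  the choices \<open>inverse (real (Suc n))\<close> would give unit vectors whose midpoint norms are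
  squeezed to 1 while their differences stay at least \<open>\<epsilon>\<close> long.\<close>

lemma uniformly_rotund_wrtD:
  fixes Y :: "'a::real_normed_vector set"
  assumes "uniformly_rotund_wrt Y" "0 < \<epsilon>"
  obtains \<delta> where "0 < \<delta>"
    "\<And>x y. \<lbrakk>norm x = 1; norm y = 1; x - y \<in> Y; \<epsilon> \<le> norm (x - y)\<rbrakk>
      \<Longrightarrow> norm ((1/2) *\<^sub>R (x + y)) \<le> 1 - \<delta>"
proof (rule ccontr)
  assume neg: "\<not> thesis"
  have "\<exists>x y. norm x = 1 \<and> norm y = 1 \<and> x - y \<in> Y \<and> \<epsilon> \<le> norm (x - y) \<and>
      1 - inverse (real (Suc n)) < norm ((1/2) *\<^sub>R (x + y))" for n
    using neg that[of "inverse (real (Suc n))"] by (force simp: not_le)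
  then obtain x y where xy: "\<And>n. norm (x n) = 1" "\<And>n. norm (y n) = 1" "\<And>n. x n - y n \<in> Y"
      "\<And>n. \<epsilon> \<le> norm (x n - y n)"
      "\<And>n. 1 - inverse (real (Suc n)) < norm ((1/2) *\<^sub>R (x n + y n))"
    by metis
  have le: "norm ((1/2) *\<^sub>R (x n + y n)) \<le> 1" for n
    using norm_triangle_ineq[of "x n" "y n"] xy(1,2)[of n] by simp
  have lim: "(\<lambda>n. 1 - inverse (real (Suc n))) \<longlonglongrightarrow> 1"
    using tendsto_diff[OF tendsto_const[of 1] LIMSEQ_inverse_real_of_nat] by (simp only: diff_0_right)
  have "(\<lambda>n. norm ((1/2) *\<^sub>R (x n + y n))) \<longlonglongrightarrow> 1"
  proof (rule tendsto_sandwich[OF _ _ lim tendsto_const])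
    show "\<forall>\<^sub>F n in sequentially. 1 - inverse (real (Suc n)) \<le> norm ((1/2) *\<^sub>R (x n + y n))"
      by (rule always_eventually[OF allI[OF less_imp_le[OF xy(5)]]])
    show "\<forall>\<^sub>F n in sequentially. norm ((1/2) *\<^sub>R (x n + y n)) \<le> 1"
      by (rule always_eventually[OF allI[OF le]])
  qed
  moreover have "\<forall>n. x n \<in> sphere 0 1" "\<forall>n. y n \<in> sphere 0 1"
    using xy(1,2) by simp_all
  ultimately have "(\<lambda>n. x n - y n) \<longlonglongrightarrow> 0"
    using assms(1) xy(3) unfolding uniformly_rotund_wrt_def by blast
  then have "\<forall>\<^sub>F n in sequentially. norm (x n - y n) < \<epsilon>"
    using tendstoD[OF _ assms(2)] by fastforce
  then show False
    using xy(4) by (simp add: not_less[symmetric] del: not_less)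
qed

lemma ray_meets_sphere:
  fixes a v :: "'a::real_normed_vector"
  assumes "norm a \<le> 1" "v \<noteq> 0"
  obtains t where "0 \<le> t" "norm (a + t *\<^sub>R v) = 1"
proof -
  \<comment> \<open>At parameter \<open>T\<close> the displacement has length 2, so the point has
    norm at least 2 - 1 = 1. At 0 the norm is at most 1, and the intermediate value theorem
    applies.\<close>
  define T where "T = 2 / norm v"
  have "norm (T *\<^sub>R v) = 2"
    using assms(2) by (simp add: T_def)
  then have "1 \<le> norm (a + T *\<^sub>R v)"
    using norm_diff_ineq[of "T *\<^sub>R v" a] assms(1) by (simp add: add.commute)
  moreover have "0 \<le> T"
    by (simp add: T_def)
  moreover have "continuous_on {0..T} (\<lambda>t. norm (a + t *\<^sub>R v))"
    by (intro continuous_intros)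
  ultimately have "\<exists>t\<ge>0. t \<le> T \<and> norm (a + t *\<^sub>R v) = 1"
    using assms(1) by (intro IVT') simp_all
  then show ?thesis
    using that by blast
qed

text \<open>By convexity, a drop of the norm at the midpoint spreads along the segment. A point of
  the half next to \<open>x\<close> mixes \<open>x\<close> with weight
  \<open>1 - 2 * \<theta>\<close> and the midpoint with weight \<open>2 * \<theta>\<close>, so it
  inherits the share \<open>2 * \<theta>\<close> of the drop. The other half follows by exchanging
  \<open>x\<close> and \<open>y\<close>.\<close>

lemma norm_convex_combination_le:
  fixes x y :: "'a::real_normed_vector"
  assumes "norm x \<le> 1" "norm y \<le> 1" "0 \<le> \<mu>" "\<mu> \<le> \<theta>" "\<mu> \<le> 1 - \<theta>"
    and mid: "norm ((1/2) *\<^sub>R (x + y)) \<le> 1 - \<delta>" and "0 \<le> \<delta>"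
  shows "norm ((1 - \<theta>) *\<^sub>R x + \<theta> *\<^sub>R y) \<le> 1 - 2 * \<mu> * \<delta>"
proof -
  have half: "norm ((1 - \<theta>) *\<^sub>R x + \<theta> *\<^sub>R y) \<le> 1 - 2 * \<mu> * \<delta>"
    if "norm x \<le> 1" "\<mu> \<le> \<theta>" "\<theta> \<le> 1/2" "norm ((1/2) *\<^sub>R (x + y)) \<le> 1 - \<delta>" for \<theta> and x y :: 'a
  proof -
    have "(1 - \<theta>) *\<^sub>R x + \<theta> *\<^sub>R y = (1 - 2 * \<theta>) *\<^sub>R x + (2 * \<theta>) *\<^sub>R ((1/2) *\<^sub>R (x + y))"
      by (simp add: algebra_simps flip: scaleR_add_left)
    also have "norm \<dots> \<le> norm ((1 - 2 * \<theta>) *\<^sub>R x) + norm ((2 * \<theta>) *\<^sub>R ((1/2) *\<^sub>R (x + y)))"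
      by (rule norm_triangle_ineq)
    also have "\<dots> = (1 - 2 * \<theta>) * norm x + (2 * \<theta>) * norm ((1/2) *\<^sub>R (x + y))"
      using that assms(3) by simp
    also have "\<dots> \<le> (1 - 2 * \<theta>) * 1 + (2 * \<theta>) * (1 - \<delta>)"
      using that assms(3) by (intro add_mono mult_left_mono) auto
    also have "\<dots> \<le> 1 - 2 * \<mu> * \<delta>"
      using mult_right_mono[OF that(2) \<open>0 \<le> \<delta>\<close>] by (simp add: algebra_simps)
    finally show ?thesis .
  qed
  show ?thesis
  proof (cases "\<theta> \<le> 1/2")
    case True
    then show ?thesis
      using half[of x \<theta> y] assms by simp
  next
    case False
    then show ?thesis
      using half[of y "1 - \<theta>" x] assms by (simp add: add.commute)
  qed
qed

text \<open>The form in which rotundity is applied: the vectors may lie slightly outside the ball,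
  and one \<open>\<delta>\<close> serves every \<open>u\<close>, so the bound survives a supremum
  over the points of a set.\<close>

lemma rotund_direction_midpoint:
  fixes z :: "'a::real_normed_vector"
  assumes ured: "uniformly_rotund_every_direction TYPE('a)" and z: "z \<noteq> 0"
  obtains \<delta> where "0 < \<delta>"
    "\<And>u. \<lbrakk>norm u \<le> 1 + \<delta>; norm (u - z) \<le> 1 + \<delta>\<rbrakk> \<Longrightarrow> norm (u - (1/2) *\<^sub>R z) \<le> 1 - \<delta>"
proof -
  have "dim (span {z}) = 1"
    using z by (simp add: dim_eq_card_independent)
  then have "uniformly_rotund_wrt (span {z})"
    using ured by (simp add: uniformly_rotund_every_direction_def)
  moreover have "0 < norm z / 2"
    using z by simp
  ultimately obtain d where d: "0 < d"
    "\<And>x y. \<lbrakk>norm x = 1; norm y = 1; x - y \<in> span {z}; norm z / 2 \<le> norm (x - y)\<rbrakk>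
      \<Longrightarrow> norm ((1/2) *\<^sub>R (x + y)) \<le> 1 - d"
    using uniformly_rotund_wrtD[of "span {z}" "norm z / 2"] by blast
  \<comment> \<open>This is the drop \<open>2 * (norm v / 4) * d\<close> obtained below, in the
    worst case \<open>norm v = norm z / 2\<close>.\<close>
  define d' where "d' = d * norm z / 4"
  have d': "0 < d'"
    using d(1) z by (simp add: d'_def)
  have unit: "norm (w - (1/2) *\<^sub>R v) \<le> 1 - d'"
    if w: "norm w \<le> 1" "norm (w - v) \<le> 1" and v: "v \<in> span {z}" "norm z / 2 \<le> norm v" for v w
  proof -
    have v0: "0 < norm v" "v \<noteq> 0"
      using v(2) z by auto
    obtain p where p: "0 \<le> p" "norm (w + p *\<^sub>R v) = 1"
      using ray_meets_sphere[OF w(1) v0(2)] .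
    obtain q where q: "0 \<le> q" "norm (w - v + q *\<^sub>R (- v)) = 1"
      using ray_meets_sphere[OF w(2), of "- v"] v0(2) by auto
    define x where "x = w + p *\<^sub>R v"
    define y where "y = w - v + q *\<^sub>R (- v)"
    \<comment> \<open>The prolonged segment from \<open>x\<close> to \<open>y\<close> is
      \<open>T\<close> times as long as \<open>v\<close>.\<close>
    define T where "T = 1 + p + q"
    have T: "1 \<le> T"
      using p q by (simp add: T_def)
    have xy: "x - y = T *\<^sub>R v"
      by (simp add: x_def y_def T_def algebra_simps)
    have nxy: "norm x = 1" "norm y = 1"
      using p q by (simp_all add: x_def y_def)
    have "norm z / 2 \<le> norm (x - y)"
      using v(2) T mult_right_mono[OF T, of "norm v"] by (simp add: xy)
    then have "norm ((1/2) *\<^sub>R (x + y)) \<le> 1 - d"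
      using v nxy by (intro d(2)) (simp_all add: xy span_scale)
    \<comment> \<open>The position of the midpoint \<open>w - (1/2) *\<^sub>R v\<close> on the
      segment from \<open>x\<close> to \<open>y\<close>. Since this chord of the unit ball has
      length at most 2, the position stays \<open>norm v / 4\<close> away from both ends.\<close>
    define \<theta> where "\<theta> = (1/2 + p) / T"
    have "T * norm v \<le> 2"
      using norm_triangle_ineq4[of x y] xy nxy T by simp
    then have "norm v / 4 \<le> (1/2) / T"
      using T by (simp add: field_simps)
    moreover have "1 - \<theta> = (1/2 + q) / T"
      using T by (simp add: \<theta>_def T_def field_simps)
    moreover have "(1/2) / T \<le> \<theta>" "(1/2) / T \<le> (1/2 + q) / T"
      unfolding \<theta>_def using T p q by (intro divide_right_mono; simp)+
    ultimately have "norm v / 4 \<le> \<theta>" "norm v / 4 \<le> 1 - \<theta>"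
      by linarith+
    then have "norm ((1 - \<theta>) *\<^sub>R x + \<theta> *\<^sub>R y) \<le> 1 - 2 * (norm v / 4) * d"
      using nxy d(1) \<open>norm ((1/2) *\<^sub>R (x + y)) \<le> 1 - d\<close>
      by (intro norm_convex_combination_le) auto
    moreover have "(1 - \<theta>) *\<^sub>R x + \<theta> *\<^sub>R y = x - (\<theta> * T) *\<^sub>R v"
    proof -
      have "(1 - \<theta>) *\<^sub>R x + \<theta> *\<^sub>R y = x - \<theta> *\<^sub>R (x - y)"
        by (simp add: algebra_simps)
      then show ?thesis
        by (simp add: xy)
    qed
    moreover have "\<dots> = w - (1/2) *\<^sub>R v"
    proof -
      have "\<theta> * T = 1/2 + p"
        using T by (simp add: \<theta>_def)
      then show ?thesis
        by (simp add: x_def scaleR_add_left)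
    qed
    moreover have "d' \<le> 2 * (norm v / 4) * d"
      using mult_left_mono[OF v(2), of d] d(1) by (simp add: d'_def field_simps)
    ultimately show ?thesis
      by simp
  qed
  \<comment> \<open>The bound \<open>\<delta> \<le> 1\<close> makes the scaling factor
    \<open>s\<close> at least 1/2, and \<open>2 * \<delta> \<le> d'\<close> makes
    \<open>(1 - d') * (1 + \<delta>)\<close> at most \<open>1 - \<delta>\<close> when the scaling is
    undone.\<close>
  define \<delta> where "\<delta> = min 1 (d' / 2)"
  have \<delta>: "0 < \<delta>" "\<delta> \<le> 1" "2 * \<delta> \<le> d'"
    using d' by (auto simp: \<delta>_def)
  show thesis
  proof (rule that[OF \<delta>(1)])
    fix u
    assume u: "norm u \<le> 1 + \<delta>" "norm (u - z) \<le> 1 + \<delta>"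
    define s where "s = 1 / (1 + \<delta>)"
    have s: "0 < s" "s * (1 + \<delta>) = 1" "1/2 \<le> s"
      using \<delta> by (auto simp: s_def field_simps)
    have "norm (s *\<^sub>R u - (1/2) *\<^sub>R (s *\<^sub>R z)) \<le> 1 - d'"
    proof (rule unit)
      show "norm (s *\<^sub>R u) \<le> 1"
        using mult_left_mono[OF u(1), of s] s by simp
      show "norm (s *\<^sub>R u - s *\<^sub>R z) \<le> 1"
        using mult_left_mono[OF u(2), of s] s by (simp flip: scaleR_diff_right)
      show "s *\<^sub>R z \<in> span {z}"
        by (simp add: span_base span_scale)
      show "norm z / 2 \<le> norm (s *\<^sub>R z)"
        using mult_right_mono[OF s(3), of "norm z"] s by simp
    qed
    also have "s *\<^sub>R u - (1/2) *\<^sub>R (s *\<^sub>R z) = s *\<^sub>R (u - (1/2) *\<^sub>R z)"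
      by (simp add: algebra_simps)
    finally have "s * norm (u - (1/2) *\<^sub>R z) \<le> 1 - d'"
      using s by simp
    then have "norm (u - (1/2) *\<^sub>R z) \<le> (1 - d') * (1 + \<delta>)"
      using \<delta> by (simp add: s_def field_simps)
    also have "\<dots> \<le> 1 - \<delta>"
    proof -
      have "(1 - d') * (1 + \<delta>) = 1 + \<delta> - d' - d' * \<delta>"
        by (simp add: algebra_simps)
      then show ?thesis
        using \<delta>(3) mult_pos_pos[OF d' \<delta>(1)] by linarith
    qed
    finally show "norm (u - (1/2) *\<^sub>R z) \<le> 1 - \<delta>" .
  qed
qed

section \<open>Far radius and centers\<close>

lemma mem_enlarge_iff:
  assumes "0 < t"
  shows "x \<in> enlarge A t \<longleftrightarrow> (\<exists>a\<in>A. norm (x - a) \<le> t)"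
proof
  assume "x \<in> enlarge A t"
  then obtain a b where "a \<in> A" "norm b \<le> 1" "x = a + t *\<^sub>R b"
    by (auto simp: enlarge_def)
  then show "\<exists>a\<in>A. norm (x - a) \<le> t"
    using assms by (intro bexI[of _ a]) (auto simp: mult_le_cancel_left1)
next
  assume "\<exists>a\<in>A. norm (x - a) \<le> t"
  then obtain a where a: "a \<in> A" "norm (x - a) \<le> t"
    by blast
  then have "norm ((1/t) *\<^sub>R (x - a)) \<le> 1"
    using assms by (simp add: divide_le_eq)
  moreover have "x = a + t *\<^sub>R ((1/t) *\<^sub>R (x - a))"
    using assms by simp
  ultimately show "x \<in> enlarge A t"
    using a(1) unfolding enlarge_def by (auto simp del: norm_scaleR intro!: exI)
qed

lemma norm_le_far_radius:
  assumes "F \<in> CB" "a \<in> F"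
  shows "norm (x - a) \<le> far_radius x F"
proof -
  obtain K where "\<And>b. b \<in> F \<Longrightarrow> norm b \<le> K"
    using assms(1) by (auto simp: CB_def bounded_iff)
  then have "norm (x - b) \<le> norm x + K" if "b \<in> F" for b
    using norm_triangle_ineq4[of x b] that by fastforce
  then show ?thesis
    unfolding far_radius_def using assms(2)
    by (intro cSUP_upper bdd_aboveI2[where M = "norm x + K"])
qed

lemma far_radius_le:
  assumes "F \<in> CB" "\<And>a. a \<in> F \<Longrightarrow> norm (x - a) \<le> r"
  shows "far_radius x F \<le> r"
  unfolding far_radius_def using assms by (intro cSUP_least) (auto simp: CB_def)

lemma far_radius_nonneg:
  assumes "F \<in> CB"
  shows "0 \<le> far_radius x F"
proof -
  obtain a where "a \<in> F"
    using assms by (auto simp: CB_def)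
  then show ?thesis
    using norm_le_far_radius[OF assms, of a x] norm_ge_zero order_trans by blast
qed

lemma rad_le_far_radius:
  assumes "F \<in> CB" "v \<in> V"
  shows "rad V F \<le> far_radius v F"
  unfolding rad_def using assms
  by (intro cINF_lower bdd_belowI2[where m = 0] far_radius_nonneg)

lemma rad_ge:
  assumes "V \<noteq> {}" "\<And>v. v \<in> V \<Longrightarrow> r \<le> far_radius v F"
  shows "r \<le> rad V F"
  unfolding rad_def using assms by (intro cINF_greatest)

lemma far_radius_lipschitz:
  assumes "F \<in> CB"
  shows "far_radius x F \<le> far_radius y F + norm (x - y)"
proof (rule far_radius_le[OF assms])
  fix a
  assume "a \<in> F"
  then show "norm (x - a) \<le> far_radius y F + norm (x - y)"
    using norm_le_far_radius[OF assms, of a y] norm_triangle_ineq[of "x - y" "y - a"] by simp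
qed

lemma continuous_on_far_radius:
  assumes "F \<in> CB"
  shows "continuous_on S (\<lambda>x. far_radius x F)"
proof (rule continuous_onI)
  fix x e
  assume "0 < (e::real)"
  moreover have "dist (far_radius y F) (far_radius x F) \<le> dist y x" for y
    using far_radius_lipschitz[OF assms, of x y] far_radius_lipschitz[OF assms, of y x]
    by (auto simp: dist_real_def dist_norm norm_minus_commute abs_le_iff)
  ultimately show "\<exists>d>0. \<forall>x'\<in>S. dist x' x < d \<longrightarrow> dist (far_radius x' F) (far_radius x F) \<le> e"
    by (meson less_imp_le order_trans)
qed

section \<open>Perturbing the set in the Hausdorff metric\<close>

lemma far_radius_le_enlarge:
  assumes "F \<in> CB" "G \<in> CB" "0 < t" "G \<subseteq> enlarge F t"
  shows "far_radius x G \<le> far_radius x F + t"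
proof (rule far_radius_le[OF assms(2)])
  fix g
  assume "g \<in> G"
  then obtain f where "f \<in> F" "norm (g - f) \<le> t"
    using assms by (auto simp: mem_enlarge_iff subset_eq)
  then show "norm (x - g) \<le> far_radius x F + t"
    using norm_le_far_radius[OF assms(1), of f x] norm_triangle_ineq4[of "x - f" "g - f"] by simp
qed

lemma rad_le_enlarge:
  assumes "V \<noteq> {}" "F \<in> CB" "G \<in> CB" "0 < t" "G \<subseteq> enlarge F t"
  shows "rad V G \<le> rad V F + t"
proof -
  have "rad V G - t \<le> far_radius v F" if "v \<in> V" for v
    using far_radius_le_enlarge[OF assms(2-5), of v] rad_le_far_radius[OF assms(3) that] by simp
  then have "rad V G - t \<le> rad V F"
    using assms(1) by (intro rad_ge)
  then show ?thesis
    by simp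
qed

text \<open>One \<open>t\<close> is lost in passing from the far radius for \<open>G\<close> to that
  for \<open>F\<close>, the other in passing from \<open>rad V G\<close> to
  \<open>rad V F\<close>.\<close>

lemma near_centers_enlarge:
  assumes "V \<noteq> {}" "F \<in> CB" "G \<in> CB" "0 < t" "F \<subseteq> enlarge G t" "G \<subseteq> enlarge F t"
  shows "near_centers V G \<delta> \<subseteq> near_centers V F (\<delta> + 2 * t)"
proof
  fix x
  assume "x \<in> near_centers V G \<delta>"
  then show "x \<in> near_centers V F (\<delta> + 2 * t)"
    using far_radius_le_enlarge[OF assms(3,2,4,5), of x] rad_le_enlarge[OF assms(1-4,6)]
    by (simp add: near_centers_def)
qed

lemma hausdorff_metric_lessD:
  assumes "F \<in> CB" "G \<in> CB" "hausdorff_metric F G < \<delta>"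
  obtains t where "0 < t" "t < \<delta>" "F \<subseteq> enlarge G t" "G \<subseteq> enlarge F t"
proof -
  let ?S = "{t. 0 < t \<and> F \<subseteq> enlarge G t \<and> G \<subseteq> enlarge F t}"
  have "bounded (F \<union> G)"
    using assms by (simp add: CB_def)
  then obtain K where K: "0 < K" "\<And>x y. \<lbrakk>x \<in> F \<union> G; y \<in> F \<union> G\<rbrakk> \<Longrightarrow> norm (x - y) \<le> K"
    by (metis bounded_two_points dist_norm less_add_one max.strict_coboundedI2 zero_less_one
        max.coboundedI1)
  \<comment> \<open>A bound on all distances within \<open>F \<union> G\<close> is an admissible
    radius. Hence the infimum is over a non-empty set, and a value below \<open>\<delta>\<close>
    yields a member below \<open>\<delta>\<close>.\<close>
  have "K \<in> ?S"
    using K assms by (force simp: mem_enlarge_iff subset_eq CB_def)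
  then have "\<exists>t\<in>?S. t < \<delta>"
    using assms(3) cInf_lessD[of ?S \<delta>] unfolding hausdorff_metric_def by blast
  then show thesis
    using that by blast
qed

lemma hausdorff_metric_self_less:
  assumes "0 < \<delta>"
  shows "hausdorff_metric F F < \<delta>"
proof -
  have "\<delta> / 2 \<in> {t. 0 < t \<and> F \<subseteq> enlarge F t \<and> F \<subseteq> enlarge F t}"
    using assms by (force simp: mem_enlarge_iff subset_eq)
  then have "hausdorff_metric F F \<le> \<delta> / 2"
    unfolding hausdorff_metric_def by (intro cInf_lower bdd_belowI[where m = 0]) auto
  then show ?thesis
    using assms by simp
qed

section \<open>Uniqueness of centers and the equivalence of the two properties\<close>

lemma centers_unique:
  fixes C :: "'a::real_normed_vector set"
  assumes ured: "uniformly_rotund_every_direction TYPE('a)"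
    and "convex C" and F: "F \<in> CB" and c: "c \<in> centers C F" "c' \<in> centers C F"
  shows "c = c'"
proof (rule ccontr)
  assume ne: "c \<noteq> c'"
  define R where "R = rad C F"
  have "far_radius c F = R" "far_radius c' F = R"
    using c by (simp_all add: centers_def R_def)
  then have far: "norm (c - a) \<le> R" "norm (c' - a) \<le> R" if "a \<in> F" for a
    using norm_le_far_radius[OF F that] by metis+
  obtain a where "a \<in> F"
    using F by (auto simp: CB_def)
  \<comment> \<open>With \<open>R \<le> 0\<close> both \<open>c\<close> and \<open>c'\<close> would
    coincide with \<open>a\<close>.\<close>
  then have R: "0 < R"
    using far[of a] ne by (metis eq_iff_diff_eq_0 norm_le_zero_iff not_le order_trans)
  \<comment> \<open>After division by \<open>R\<close>, the vectors \<open>c - a\<close> and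
    \<open>c' - a\<close> lie in the unit ball, and their difference does not depend on
    \<open>a\<close>. So a single \<open>\<delta>\<close> bounds the distances from the midpoint to
    all points of \<open>F\<close>.\<close>
  obtain \<delta> where \<delta>: "0 < \<delta>" "\<And>u. \<lbrakk>norm u \<le> 1 + \<delta>; norm (u - (1/R) *\<^sub>R (c - c')) \<le> 1 + \<delta>\<rbrakk>
      \<Longrightarrow> norm (u - (1/2) *\<^sub>R ((1/R) *\<^sub>R (c - c'))) \<le> 1 - \<delta>"
    using rotund_direction_midpoint[OF ured, of "(1/R) *\<^sub>R (c - c')"] ne R by auto
  have scaled: "norm ((1/R) *\<^sub>R w) \<le> 1" if "norm w \<le> R" for w :: 'a
    using that R by (simp add: divide_le_eq)
  define m where "m = (1/2) *\<^sub>R c + (1/2) *\<^sub>R c'"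
  have "m \<in> C"
    unfolding m_def using \<open>convex C\<close> c by (intro convexD) (auto simp: centers_def)
  have "far_radius m F \<le> R * (1 - \<delta>)"
  proof (rule far_radius_le[OF F])
    fix a
    assume a: "a \<in> F"
    have "norm ((1/R) *\<^sub>R (c - a) - (1/2) *\<^sub>R ((1/R) *\<^sub>R (c - c'))) \<le> 1 - \<delta>"
    proof (rule \<delta>(2))
      show "norm ((1/R) *\<^sub>R (c - a)) \<le> 1 + \<delta>"
        using scaled[OF far(1)[OF a]] \<delta>(1) by linarith
      have "norm ((1/R) *\<^sub>R (c - a) - (1/R) *\<^sub>R (c - c')) = norm ((1/R) *\<^sub>R (c' - a))"
        by (simp flip: scaleR_diff_right)
      then show "norm ((1/R) *\<^sub>R (c - a) - (1/R) *\<^sub>R (c - c')) \<le> 1 + \<delta>"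
        using scaled[OF far(2)[OF a]] \<delta>(1) by linarith
    qed
    moreover have "(1/R) *\<^sub>R (c - a) - (1/2) *\<^sub>R ((1/R) *\<^sub>R (c - c')) = (1/R) *\<^sub>R (m - a)"
    proof -
      have "c - a - (1/2) *\<^sub>R (c - c') = m - a"
        by (simp add: m_def algebra_simps) (simp flip: scaleR_add_left)
      then show ?thesis
        by (metis scaleR_diff_right scaleR_left_commute)
    qed
    ultimately show "norm (m - a) \<le> R * (1 - \<delta>)"
      using R by (simp add: divide_le_eq mult.commute)
  qed
  also have "\<dots> < R"
    using R \<delta>(1) by simp
  finally show False
    using rad_le_far_radius[OF F \<open>m \<in> C\<close>] by (simp add: R_def)
qed

text \<open>By uniqueness, \<open>property_P1\<close> at \<open>F\<close> confines the near-centers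
  of \<open>F\<close> to a small ball around one point. Near-centers of a set \<open>G\<close> close
  to \<open>F\<close> fall into this ball, and so does a center of \<open>G\<close>, so they are
  close to that center.\<close>

lemma property_P1_iff_lP2:
  fixes C :: "'a::real_normed_vector set"
  assumes ured: "uniformly_rotund_every_direction TYPE('a)"
    and C: "C \<in> CL" "convex C" and \<F>: "\<F> \<subseteq> CB"
  shows "property_P1 C \<F> \<longleftrightarrow> property_lP2 C \<F>"
proof
  assume P1: "property_P1 C \<F>"
  have "\<exists>\<delta>>0. \<forall>G\<in>\<F>. hausdorff_metric F G < \<delta> \<longrightarrow> near_centers C G \<delta> \<subseteq> enlarge (centers C G) \<epsilon>"
    if \<epsilon>: "0 < \<epsilon>" and F: "F \<in> \<F>" for \<epsilon> F
  proof -
    from P1 F obtain c where c: "c \<in> centers C F"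
      unfolding property_P1_def by blast
    have "0 < \<epsilon> / 2"
      using \<epsilon> by simp
    with P1 F obtain \<delta> where \<delta>: "0 < \<delta>" "near_centers C F \<delta> \<subseteq> enlarge (centers C F) (\<epsilon> / 2)"
      unfolding property_P1_def by blast
    have near: "norm (x - c) \<le> \<epsilon> / 2" if "x \<in> near_centers C F \<delta>" for x
      using \<delta>(2) that centers_unique[OF ured C(2) _ c] F \<F> \<epsilon>
      by (auto simp: mem_enlarge_iff subset_eq)
    show ?thesis
    \<comment> \<open>A third suffices: for \<open>t < \<delta> / 3\<close> the enlarged tolerance
      \<open>\<delta> / 3 + 2 * t\<close> is below \<open>\<delta>\<close>.\<close>
    proof (intro exI[of _ "\<delta> / 3"] conjI ballI impI subsetI)
      show "0 < \<delta> / 3"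
        using \<delta>(1) by simp
      fix G x
      assume G: "G \<in> \<F>" "hausdorff_metric F G < \<delta> / 3" and x: "x \<in> near_centers C G (\<delta> / 3)"
      have CB: "F \<in> CB" "G \<in> CB"
        using F G \<F> by auto
      obtain t where t: "0 < t" "t < \<delta> / 3" "F \<subseteq> enlarge G t" "G \<subseteq> enlarge F t"
        using hausdorff_metric_lessD[OF CB G(2)] .
      have sub: "near_centers C G (\<delta> / 3) \<subseteq> near_centers C F \<delta>"
        using near_centers_enlarge[OF _ CB t(1,3,4), of C "\<delta> / 3"] C(1) t(2)
        by (force simp: CL_def near_centers_def)
      obtain g where g: "g \<in> centers C G"
        using P1 G(1) unfolding property_P1_def by blast
      then have "g \<in> near_centers C G (\<delta> / 3)"
        using \<delta>(1) by (simp add: centers_def near_centers_def)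
      then have "norm (x - c) \<le> \<epsilon> / 2" "norm (g - c) \<le> \<epsilon> / 2"
        using near sub x by blast+
      then have "norm (x - g) \<le> \<epsilon>"
        using norm_triangle_ineq4[of "x - c" "g - c"] by simp
      then show "x \<in> enlarge (centers C G) \<epsilon>"
        using g \<epsilon> by (auto simp: mem_enlarge_iff)
    qed
  qed
  then show "property_lP2 C \<F>"
    using P1 unfolding property_P1_def property_lP2_def by blast
next
  assume lP2: "property_lP2 C \<F>"
  then show "property_P1 C \<F>"
    \<comment> \<open>Take \<open>G = F\<close>, which lies at Hausdorff distance less than any
      positive number from itself.\<close>
    unfolding property_P1_def property_lP2_def by (meson hausdorff_metric_self_less)
qed

section \<open>Finite-dimensional subspaces\<close>

text \<open>Induction on the spanning set. A new vector \<open>b\<close> outside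
  \<open>span B\<close> has positive distance from it, which bounds the coefficient of
  \<open>b\<close> in vectors of bounded norm. The slice is then a closed part of the continuous
  image of an interval times a smaller compact slice.\<close>

lemma compact_span_Int_cball:
  fixes B :: "'a::real_normed_vector set"
  assumes "finite B"
  shows "compact (span B \<inter> cball 0 r)"
  using assms
proof (induction B arbitrary: r rule: finite_induct)
  case empty
  then show ?case
    by (auto simp: finite_imp_compact)
next
  case (insert b B)
  show ?case
  proof (cases "b \<in> span B")
    case True
    then show ?thesis
      using insert.IH by (simp add: span_redundant)
  next
    case False
    \<comment> \<open>The induction hypothesis gives closedness of bounded slices. Radius
      \<open>2 * norm b\<close> is enough, since any longer vector is farther than
      \<open>norm b\<close> from \<open>b\<close>.\<close>
    have "closed (span B \<inter> cball 0 (2 * norm b))"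
      by (rule compact_imp_closed[OF insert.IH])
    moreover have "b \<in> - (span B \<inter> cball 0 (2 * norm b))"
      using False by simp
    ultimately obtain d where d: "0 < d" "ball b d \<subseteq> - (span B \<inter> cball 0 (2 * norm b))"
      unfolding closed_def by (meson openE)
    define e where "e = min d (norm b)"
    have e: "0 < e"
      using d(1) False span_zero by (auto simp: e_def)
    have far: "e \<le> norm (b - s)" if "s \<in> span B" for s
    proof (cases "norm s \<le> 2 * norm b")
      case True
      then have "s \<notin> ball b d"
        using d(2) that by auto
      then show ?thesis
        by (simp add: e_def dist_norm not_less min.coboundedI1)
    next
      case False
      then show ?thesis
        using norm_triangle_ineq2[of s b] by (simp add: e_def norm_minus_commute)
    qed
    define K where "K = \<bar>r\<bar> / e"
    define P where "P = (\<lambda>(t, s). t *\<^sub>R b + s) ` ({-K..K} \<times> (span B \<inter> cball 0 (\<bar>r\<bar> + K * norm b)))"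
    have "compact P"
      unfolding P_def case_prod_unfold
      by (intro compact_continuous_image compact_Times insert.IH compact_Icc continuous_intros)
    moreover have "span (insert b B) \<inter> cball 0 r = P \<inter> cball 0 r"
    proof (intro set_eqI iffI)
      fix x
      assume x: "x \<in> span (insert b B) \<inter> cball 0 r"
      then obtain t where t: "x - t *\<^sub>R b \<in> span B"
        by (auto simp: span_insert)
      have "\<bar>t\<bar> * e \<le> norm x"
      proof (cases "t = 0")
        case False
        \<comment> \<open>Subtracting this vector from \<open>b\<close> gives
          \<open>(1/t) *\<^sub>R x\<close>, so the distance bound \<open>e\<close> applies to the
          latter.\<close>
        have "- ((1/t) *\<^sub>R (x - t *\<^sub>R b)) \<in> span B"
          using t by (intro span_neg span_scale)
        from far[OF this] have "e \<le> norm ((1/t) *\<^sub>R x)"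
          using False by (simp add: algebra_simps)
        then show ?thesis
          using False by (simp add: field_simps)
      qed simp
      then have "\<bar>t\<bar> * e \<le> \<bar>r\<bar>"
        using x by auto
      then have "\<bar>t\<bar> \<le> K"
        using e by (simp add: K_def le_divide_eq)
      moreover have "norm (x - t *\<^sub>R b) \<le> \<bar>r\<bar> + K * norm b"
        using norm_triangle_ineq4[of x "t *\<^sub>R b"] x mult_right_mono[OF \<open>\<bar>t\<bar> \<le> K\<close>, of "norm b"] by auto
      ultimately have "x \<in> P"
        unfolding P_def using t
        by (intro image_eqI[of _ _ "(t, x - t *\<^sub>R b)"]) (auto simp: abs_le_iff)
      then show "x \<in> P \<inter> cball 0 r"
        using x by simp
    next
      fix x
      assume x: "x \<in> P \<inter> cball 0 r"
      then obtain t s where "x = t *\<^sub>R b + s" "s \<in> span B"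
        unfolding P_def by auto
      then have "x - t *\<^sub>R b \<in> span B"
        by simp
      then show "x \<in> span (insert b B) \<inter> cball 0 r"
        using x unfolding span_insert by blast
    qed
    ultimately show ?thesis
      by (simp add: compact_Int_closed)
  qed
qed

lemma finite_dim_subspace_compact:
  assumes "finite_dim_subspace Y"
  shows "compact (Y \<inter> cball 0 r)"
  using assms compact_span_Int_cball unfolding finite_dim_subspace_def by auto

text \<open>With \<open>r\<close> the far radius of 0, every point of \<open>F\<close> has norm at
  most \<open>r\<close>, so a \<open>v\<close> with norm above \<open>2 * r\<close> has far radius
  at least \<open>r\<close> and does not beat 0. It remains to minimize a continuous function on a
  compact slice of \<open>Y\<close>.\<close>

lemma centers_finite_dim_nonempty:
  assumes Y: "finite_dim_subspace Y" and F: "F \<in> CB"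
  shows "centers Y F \<noteq> {}"
proof -
  define r where "r = far_radius 0 F"
  have 0: "0 \<in> Y"
    using Y by (simp add: finite_dim_subspace_def subspace_0)
  moreover have "0 \<le> r"
    by (simp add: r_def far_radius_nonneg[OF F])
  ultimately have ne: "0 \<in> Y \<inter> cball 0 (2 * r)"
    by simp
  obtain c where c: "c \<in> Y \<inter> cball 0 (2 * r)"
    "\<And>v. v \<in> Y \<inter> cball 0 (2 * r) \<Longrightarrow> far_radius c F \<le> far_radius v F"
    using continuous_attains_inf[OF finite_dim_subspace_compact[OF Y] _
        continuous_on_far_radius[OF F]] ne by blast
  have "far_radius c F \<le> far_radius v F" if v: "v \<in> Y" for v
  proof (cases "norm v \<le> 2 * r")
    case True
    then show ?thesis
      using c(2) v by simp
  next
    case False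
    obtain a where a: "a \<in> F"
      using F by (auto simp: CB_def)
    have "far_radius c F \<le> r"
      using c(2)[OF ne] by (simp add: r_def)
    also have "r \<le> norm (v - a)"
      using False norm_le_far_radius[OF F a, of 0] norm_triangle_ineq2[of v a] by (simp add: r_def)
    also have "\<dots> \<le> far_radius v F"
      by (rule norm_le_far_radius[OF F a])
    finally show ?thesis .
  qed
  then have "far_radius c F \<le> rad Y F"
    using 0 by (intro rad_ge) auto
  then have "c \<in> centers Y F"
    using rad_le_far_radius[OF F, of c Y] c(1) by (simp add: centers_def)
  then show ?thesis
    by blast
qed

section \<open>Uniformity over all sets of radius one\<close>

lemma property_P2_finite_dim:
  fixes Y :: "'a::real_normed_vector set"
  assumes ured: "uniformly_rotund_every_direction TYPE('a)" and Y: "finite_dim_subspace Y"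
  shows "property_P2 Y {F \<in> CB. rad Y F = 1}"
proof -
  have sub: "subspace Y"
    using Y by (simp add: finite_dim_subspace_def)
  have "\<exists>\<delta>>0. \<forall>G\<in>{F \<in> CB. rad Y F = 1}. near_centers Y G \<delta> \<subseteq> enlarge (centers Y G) \<epsilon>"
    if \<epsilon>: "0 < \<epsilon>" for \<epsilon>
  proof (rule ccontr)
    assume neg: "\<not> ?thesis"
    have "\<exists>G y c. G \<in> CB \<and> rad Y G = 1 \<and> y \<in> near_centers Y G (inverse (real (Suc n))) \<and>
        c \<in> centers Y G \<and> \<epsilon> < norm (c - y)" for n
    proof -
      have "0 < inverse (real (Suc n))"
        by simp
      with neg obtain G y where G: "G \<in> CB" "rad Y G = 1"
          "y \<in> near_centers Y G (inverse (real (Suc n)))" "y \<notin> enlarge (centers Y G) \<epsilon>"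
        by blast
      obtain c where c: "c \<in> centers Y G"
        using centers_finite_dim_nonempty[OF Y G(1)] by blast
      \<comment> \<open>Being outside the enlargement, \<open>y\<close> is farther than
        \<open>\<epsilon>\<close> from every center, whichever \<open>c\<close> was chosen.\<close>
      then have "\<epsilon> < norm (c - y)"
        using G(4) \<epsilon> by (auto simp: mem_enlarge_iff not_le norm_minus_commute)
      then show ?thesis
        using G c by blast
    qed
    then obtain G y c where G: "\<And>n. G n \<in> CB" "\<And>n. rad Y (G n) = 1"
        and y: "\<And>n. y n \<in> near_centers Y (G n) (inverse (real (Suc n)))"
        and c: "\<And>n. c n \<in> centers Y (G n)" and far: "\<And>n. \<epsilon> < norm (c n - y n)"
      by metis
    have YY: "c n \<in> Y" "y n \<in> Y" for n
      using c[of n] y[of n] by (auto simp: centers_def near_centers_def)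
    have nc: "norm (c n - a) \<le> 1" if "a \<in> G n" for n a
      using norm_le_far_radius[OF G(1) that, of "c n"] c[of n] G(2)[of n] by (simp add: centers_def)
    have ny: "norm (y n - a) \<le> 1 + inverse (real (Suc n))" if "a \<in> G n" for n a
      using norm_le_far_radius[OF G(1) that, of "y n"] y[of n] G(2)[of n] by (simp add: near_centers_def)
    \<comment> \<open>The sets \<open>G n\<close> need not share a bounded region, so compactness is
      applied to differences. Through a common point \<open>a\<close> of \<open>G n\<close> they
      have norm at most 1 + 2.\<close>
    have "c n - y n \<in> Y \<inter> cball 0 3" for n
    proof -
      obtain a where "a \<in> G n"
        using G(1)[of n] by (auto simp: CB_def)
      moreover have "inverse (real (Suc n)) \<le> 1"
        by (simp add: field_simps)
      ultimately have "norm (c n - y n) \<le> 3"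
        using nc[of a n] ny[of a n] norm_triangle_ineq4[of "c n - a" "y n - a"] by simp
      then show ?thesis
        using YY sub by (simp add: subspace_diff)
    qed
    then obtain z \<phi> where \<phi>: "strict_mono \<phi>" "(\<lambda>n. c (\<phi> n) - y (\<phi> n)) \<longlonglongrightarrow> z"
      using finite_dim_subspace_compact[OF Y, of 3, unfolded compact_def, rule_format,
          of "\<lambda>n. c n - y n"]
      unfolding o_def by blast
    have "\<epsilon> \<le> norm z"
      using far by (intro LIMSEQ_le_const[OF tendsto_norm[OF \<phi>(2)]]) (auto intro: less_imp_le)
    then have "z \<noteq> 0"
      using \<epsilon> by auto
    then obtain \<delta> where \<delta>: "0 < \<delta>"
        "\<And>u. \<lbrakk>norm u \<le> 1 + \<delta>; norm (u - z) \<le> 1 + \<delta>\<rbrakk> \<Longrightarrow> norm (u - (1/2) *\<^sub>R z) \<le> 1 - \<delta>"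
      using rotund_direction_midpoint[OF ured] by blast
    \<comment> \<open>Two errors of \<open>\<delta> / 2\<close> are allowed: replacing
      \<open>c n - y n\<close> by the fixed direction \<open>z\<close>, and the excess of the
      near-center \<open>y n\<close> over radius 1. Together they give the tolerance
      \<open>1 + \<delta>\<close>.\<close>
    have "\<forall>\<^sub>F n in sequentially. norm (c (\<phi> n) - y (\<phi> n) - z) < \<delta> / 2"
      using tendstoD[OF \<phi>(2), of "\<delta> / 2"] \<delta>(1) by (simp add: dist_norm)
    moreover have "\<forall>\<^sub>F n in sequentially. inverse (real (Suc (\<phi> n))) < \<delta> / 2"
      using order_tendstoD(2)[OF LIMSEQ_subseq_LIMSEQ[OF LIMSEQ_inverse_real_of_nat \<phi>(1)], of "\<delta> / 2"]
        \<delta>(1) by (simp add: o_def)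
    ultimately obtain k where k: "norm (c (\<phi> k) - y (\<phi> k) - z) < \<delta> / 2"
        "inverse (real (Suc (\<phi> k))) < \<delta> / 2"
      using eventually_happens[OF eventually_conj] by fastforce
    define n where "n = \<phi> k"
    define m where "m = (1/2) *\<^sub>R (c n + y n)"
    have "m \<in> Y"
      unfolding m_def using YY sub by (intro subspace_scale subspace_add)
    have "far_radius m (G n) \<le> 1 - \<delta> / 2"
    proof (rule far_radius_le[OF G(1)])
      fix a
      assume a: "a \<in> G n"
      have "norm (c n - a - z) \<le> norm (y n - a) + norm (c n - y n - z)"
        using norm_triangle_ineq[of "y n - a" "c n - y n - z"] by (simp add: algebra_simps)
      then have "norm (c n - a - z) \<le> 1 + \<delta>"
        using ny[OF a] k by (simp add: n_def)
      moreover have "norm (c n - a) \<le> 1 + \<delta>"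
        using nc[OF a] \<delta>(1) by simp
      ultimately have "norm (c n - a - (1/2) *\<^sub>R z) \<le> 1 - \<delta>"
        using \<delta>(2) by blast
      \<comment> \<open>The actual midpoint differs from the one for direction \<open>z\<close> by
        half of \<open>c n - y n - z\<close>, which costs less than \<open>\<delta> / 4\<close> of
        the gain \<open>\<delta>\<close>.\<close>
      moreover have "m - a = (c n - a - (1/2) *\<^sub>R z) - (1/2) *\<^sub>R (c n - y n - z)"
        by (simp add: m_def algebra_simps) (simp flip: scaleR_add_left)
      then have "norm (m - a) \<le> norm (c n - a - (1/2) *\<^sub>R z) + norm (c n - y n - z) / 2"
        using norm_triangle_ineq4[of "c n - a - (1/2) *\<^sub>R z" "(1/2) *\<^sub>R (c n - y n - z)"]
        by (metis norm_scaleR abs_of_nonneg divide_nonneg_nonneg mult.commute mult_1 times_divide_eq_right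
            zero_le_numeral zero_le_one)
      ultimately show "norm (m - a) \<le> 1 - \<delta> / 2"
        using k(1) \<delta>(1) by (simp add: n_def)
    qed
    then show False
      using rad_le_far_radius[OF G(1) \<open>m \<in> Y\<close>, of n] G(2)[of n] \<delta>(1) by simp
  qed
  then show ?thesis
    using centers_finite_dim_nonempty[OF Y] by (simp add: property_P2_def)
qed

theorem proposition3p13:
  assumes "uniformly_rotund_every_direction TYPE('a::banach)"
  shows "(\<forall>(C :: 'a set) (\<F> :: 'a set set).
            C \<in> CL \<and> convex C \<and> \<F> \<subseteq> CB \<longrightarrow>
            (property_P1 C \<F> \<longleftrightarrow> property_lP2 C \<F>)) \<and>
         (\<forall>Y :: 'a set. finite_dim_subspace Y \<longrightarrow>
            property_P2 Y {F \<in> CB. rad Y F = 1})"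
  using property_P1_iff_lP2[OF assms] property_P2_finite_dim[OF assms] by simp

end
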